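(* There exists a universal constant $c>0$ such that, for every continuous map $f:\mathbb S^1\to\mathbb S^1$ and every real $\delta$ with $0<\delta\le\sqrt3$, \[ |\deg f|\le c\,\delta\, I_\delta(f). \]
   Context: $\mathbb S^1=\{z\in\mathbb C:|z|=1\}$ is equipped with arclength measure (total mass $2\pi$), and $|x-y|$ is the Euclidean chordal distance in $\mathbb C$. For a continuous $f:\mathbb S^1\to\mathbb S^1$, $\deg f\in\mathbb Z$ is the usual winding number. For $\delta>0$, \[ I_\delta(f)=\int_{\mathbb S^1}\int_{\mathbb S^1}\frac{\mathbf 1_{\{|f(x)-f(y)|\ge\delta\}}}{|x-y|^2}\,\mathrm{d}x\,\mathrm{d}y, \] where $\mathbf 1_{\{|f(x)-f(y)|\ge\delta\}}$ equals $1$ if $|f(x)-f(y)|\ge\delta$ and $0$ otherwise. "Universal" means that $c$ does not depend on $f$ or $\delta$. *)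

theory Defs
  imports "HOL-Complex_Analysis.Complex_Analysis"
begin

abbreviation unit_circle :: "complex set"
  where "unit_circle \<equiv> sphere 0 1"

text \<open>Arclength measure is the image of Lebesgue measure under the arclength
  parametrisation \<open>t \<mapsto> cis t\<close>, a bijection from \<open>{0..<2 * pi}\<close> onto the circle.\<close>

definition arclength :: "complex measure"
  where "arclength =
    distr (restrict_space lborel {0..<2 * pi}) (restrict_space borel unit_circle) cis"

lemma cis_measurable:
  "cis \<in> measurable (restrict_space lborel {0..<2 * pi}) (restrict_space borel unit_circle)"
proof -
  have "cis \<in> borel_measurable borel"
    by (intro borel_measurable_continuous_onI continuous_intros)
  then have "cis \<in> borel_measurable lborel" by simp
  then have "cis \<in> borel_measurable (restrict_space lborel {0..<2 * pi})"
    by (rule measurable_restrict_space1)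
  then show ?thesis
    by (intro measurable_restrict_space2) auto
qed

lemma space_arclength: "space arclength = unit_circle"
  by (simp add: arclength_def space_restrict_space)

lemma sets_arclength: "sets arclength = sets (restrict_space borel unit_circle)"
  by (simp add: arclength_def)

lemma emeasure_arclength_total: "emeasure arclength unit_circle = ennreal (2 * pi)"
proof -
  have "unit_circle \<in> sets (restrict_space borel unit_circle)"
    by (metis sets.top space_restrict_space2 space_borel sets_restrict_space_iff
        space_restrict_space Int_UNIV_right)
  then have "emeasure arclength unit_circle
      = emeasure (restrict_space lborel {0..<2 * pi})
          (cis -` unit_circle \<inter> space (restrict_space lborel {0..<2 * pi}))"
    unfolding arclength_def by (intro emeasure_distr cis_measurable)
  also have "cis -` unit_circle \<inter> space (restrict_space lborel {0..<2 * pi}) = {0..<2 * pi}"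
    by (auto simp: space_restrict_space)
  also have "emeasure (restrict_space lborel {0..<2 * pi}) {0..<2 * pi} = ennreal (2 * pi)"
    by (subst emeasure_restrict_space) auto
  finally show ?thesis .
qed

text \<open>The library's winding number is complex-valued; \<open>circle_degree_eq_winding_number\<close>
  shows that the floor below loses nothing for continuous circle maps.\<close>

definition circle_degree :: "(complex \<Rightarrow> complex) \<Rightarrow> int"
  where "circle_degree f = \<lfloor>Re (winding_number (f \<circ> circlepath 0 1) 0)\<rfloor>"

lemma circle_degree_eq_winding_number:
  assumes "continuous_on unit_circle f" "f ` unit_circle \<subseteq> unit_circle"
  shows "of_int (circle_degree f) = winding_number (f \<circ> circlepath 0 1) 0"
proof -
  have "path (f \<circ> circlepath 0 1)"
    by (rule path_continuous_image) (use assms in simp_all)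
  moreover have "pathfinish (f \<circ> circlepath 0 1) = pathstart (f \<circ> circlepath 0 1)"
    by (simp add: pathfinish_compose pathstart_compose)
  moreover have "0 \<notin> path_image (f \<circ> circlepath 0 1)"
    using assms(2) by (auto simp: path_image_compose)
  ultimately have "winding_number (f \<circ> circlepath 0 1) 0 \<in> \<int>"
    by (rule integer_winding_number)
  then show ?thesis
    by (auto simp: circle_degree_def elim!: Ints_cases)
qed

text \<open>The value is in \<open>[0, \<infinity>]\<close>. On the diagonal the integrand is \<open>0\<close>
  whenever \<open>\<delta> > 0\<close>, so the convention for division by zero plays no role.\<close>

definition I_delta :: "real \<Rightarrow> (complex \<Rightarrow> complex) \<Rightarrow> ennreal"
  where "I_delta \<delta> f =
    (\<integral>\<^sup>+ y. \<integral>\<^sup>+ x.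
        ennreal ((if cmod (f x - f y) \<ge> \<delta> then 1 else 0) / (cmod (x - y))\<^sup>2)
      \<partial>arclength \<partial>arclength)"

end

theory Submission imports Defs begin

text \<open>The factor \<open>\<delta>\<close> on the right-hand side comes for free from powers: \<open>f\<^sup>k\<close> has degree \<open>k\<close> times
  that of \<open>f\<close>, and \<open>\<bar>f(x)\<^sup>k - f(y)\<^sup>k\<bar> \<le> k \<bar>f(x) - f(y)\<bar>\<close>, so pairs at distance at least \<open>\<surd>3\<close> for \<open>f\<^sup>k\<close>
  are at distance at least \<open>\<surd>3 / k\<close> for \<open>f\<close>. Taking \<open>k\<close> to be the integer part of \<open>\<surd>3 / \<delta>\<close> reduces the
  claim to the threshold \<open>\<surd>3\<close>, the distance between two vertices of an equilateral triangle inscribed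
  in the circle.

  For that threshold, cut the circle into \<open>2 ^ n\<close> equal arcs and integrate \<open>F = f \<circ> cis\<close> over each. The
  integrals form a closed polygon in the plane; let \<open>level_turn n\<close> be the total angle it turns through
  as seen from the origin. At level \<open>0\<close> the polygon is a single point and the angle is \<open>0\<close>; at a
  sufficiently fine level it is \<open>2 * pi\<close> times the degree (\<open>level_turn_eventually\<close>). The change from one
  level to the next is a sum of contributions of pentagons (\<open>level_turn_diff\<close>), each spanned by integrals of
  \<open>F\<close> over subarcs of one arc, a window of length \<open>h = 4 * pi / 2 ^ n\<close>. Such a contribution is
  bounded, and it vanishes if the five vertices lie in an open half plane.

  When they do not, the window carries many pairs of points with far apart values: the measure of
  these pairs is at least \<open>h\<^sup>2 / 2500\<close>. This is the contrapositive of
  \<open>few_far_pairs_imp_half_plane\<close>, which is where \<open>\<surd>3\<close> matters: two points of the circle have distance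
  less than \<open>\<surd>3\<close> exactly when their angle is less than \<open>2 * pi / 3\<close>, and a distribution on the circle
  almost all of whose pairs are that close is, up to a small mass, supported in an arc hardly
  longer than \<open>2 * pi / 3\<close>, hence inside a half plane.

  Every contributing window is therefore paid for by \<open>h\<^sup>-\<^sup>2\<close> times the measure of its far pairs. A pair
  \<open>(s, t)\<close> lies in at most two windows of each level with \<open>h > \<bar>s - t\<bar>\<close> and in no other, so the sum
  of \<open>h\<^sup>-\<^sup>2\<close> over all windows that contain it is geometric and at most a constant times
  \<open>1 / \<bar>s - t\<bar>\<^sup>2\<close> (\<open>sum_windows_le_gap_kernel\<close>). Chords are shorter than arcs, so
  integrating over all pairs gives the estimate.\<close>

section \<open>Circle-valued random variables with few far pairs\<close>

lemma borel_measurable_Arg [measurable]: "Arg \<in> borel_measurable borel"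
proof -
  have neg: "\<real>\<^sub>\<le>\<^sub>0 \<in> sets (borel :: complex measure)"
    by (intro borel_closed) simp
  have "(\<lambda>z. indicator (- \<real>\<^sub>\<le>\<^sub>0) z *\<^sub>R Arg z) \<in> borel_measurable borel"
    using neg by (intro borel_measurable_continuous_on_indicator continuous_on_Arg) auto
  moreover have "(\<lambda>z. pi * indicator (\<real>\<^sub>\<le>\<^sub>0 - {0}) z) \<in> borel_measurable (borel :: complex measure)"
    using neg by (intro borel_measurable_times borel_measurable_indicator) auto
  ultimately have "(\<lambda>z. indicator (- \<real>\<^sub>\<le>\<^sub>0) z *\<^sub>R Arg z + pi * indicator (\<real>\<^sub>\<le>\<^sub>0 - {0}) z)
      \<in> borel_measurable (borel :: complex measure)"
    by (rule borel_measurable_add)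
  also have "(\<lambda>z. indicator (- \<real>\<^sub>\<le>\<^sub>0) z *\<^sub>R Arg z + pi * indicator (\<real>\<^sub>\<le>\<^sub>0 - {0}) z) = Arg"
  proof
    fix z :: complex
    show "indicator (- \<real>\<^sub>\<le>\<^sub>0) z *\<^sub>R Arg z + pi * indicator (\<real>\<^sub>\<le>\<^sub>0 - {0}) z = Arg z"
    proof (cases "z \<in> \<real>\<^sub>\<le>\<^sub>0 \<and> z \<noteq> 0")
      case True
      then have "Arg z = pi"
        by (auto elim!: nonpos_Reals_cases simp: Arg_eq_pi)
      with True show ?thesis by simp
    qed (auto simp: Arg_zero)
  qed
  finally show ?thesis .
qed

lemma cos_le_minus_half:
  assumes "2 * pi / 3 \<le> x" "x \<le> 4 * pi / 3"
  shows "cos x \<le> - 1 / 2"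
proof -
  \<comment> \<open>Reflected at \<open>pi\<close>, the range is \<open>\<bar>x - pi\<bar> \<le> pi / 3\<close>, where the cosine is at least \<open>1 / 2\<close>.\<close>
  have "cos (pi / 3) \<le> cos \<bar>x - pi\<bar>"
    using assms by (intro cos_monotone_0_pi_le) (auto simp: abs_if)
  then show ?thesis by (simp add: cos_60 cos_diff)
qed

lemma abs_less_of_cos_greater:
  assumes "cos x > - 1 / 2" "\<bar>x\<bar> \<le> pi"
  shows "\<bar>x\<bar> < 2 * pi / 3"
proof (rule ccontr)
  assume "\<not> ?thesis"
  then have "cos \<bar>x\<bar> \<le> - 1 / 2"
    using assms by (intro cos_le_minus_half) auto
  with assms show False by simp
qed

text \<open>The slack \<open>1 / 4\<close> absorbs the resolution of the quantiles in \<open>few_far_pairs_imp_half_plane\<close>.\<close>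

lemma cos_ge_quarter:
  assumes "\<bar>x\<bar> \<le> pi / 3 + 1 / 4"
  shows "cos x \<ge> 1 / 4"
proof -
  have "cos (pi / 3 + 1 / 4) \<le> cos \<bar>x\<bar>"
    using assms pi_gt3 by (intro cos_monotone_0_pi_le) auto
  moreover have "cos (pi / 3 + 1 / 4) \<ge> 1 / 4"
  proof -
    have s: "sin (1 / 4 :: real) \<le> 1 / 4" by (rule sin_x_le_x) simp
    have c: "cos (1 / 4 :: real) \<ge> 15 / 16"
    proof -
      have "(sin (1 / 8 :: real))\<^sup>2 \<le> (1 / 8)\<^sup>2"
        by (intro power_mono sin_x_le_x sin_ge_zero) (use pi_gt3 in auto)
      moreover have "cos (2 * (1 / 8) :: real) = 1 - 2 * (sin (1 / 8))\<^sup>2"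
        by (rule cos_double_sin)
      ultimately show ?thesis by (simp add: power2_eq_square)
    qed
    have "sqrt 3 \<le> 7 / 4" by (rule real_le_lsqrt) (auto simp: power2_eq_square)
    then have "sqrt 3 * sin (1 / 4) \<le> 7 / 4 * (1 / 4)"
      using s by (intro mult_mono) (auto intro!: sin_ge_zero order.trans[OF _ less_imp_le[OF pi_gt3]])
    then show ?thesis
      using c by (simp add: cos_add cos_60 sin_60)
  qed
  ultimately show ?thesis by simp
qed

lemma cmod_cis_diff_sq: "(cmod (cis a - cis b))\<^sup>2 = 2 - 2 * cos (a - b)"
proof -
  have "(cmod (cis a - cis b))\<^sup>2 =
      ((cos a)\<^sup>2 + (sin a)\<^sup>2) + ((cos b)\<^sup>2 + (sin b)\<^sup>2) - 2 * (cos a * cos b + sin a * sin b)"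
    unfolding cmod_power2 by (simp add: power2_eq_square algebra_simps)
  then show ?thesis by (simp add: cos_diff)
qed

lemma far_cis_iff: "sqrt 3 \<le> cmod (cis a - cis b) \<longleftrightarrow> cos (a - b) \<le> - 1 / 2"
proof -
  have "sqrt 3 \<le> cmod (cis a - cis b) \<longleftrightarrow> 3 \<le> (cmod (cis a - cis b))\<^sup>2"
    by (metis norm_ge_zero real_sqrt_le_iff real_sqrt_unique)
  then show ?thesis by (auto simp: cmod_cis_diff_sq)
qed

text \<open>A quantile up to the resolution \<open>\<tau>\<close>. Asking only for this avoids one-sided continuity of the
  distribution function: the least point of the grid \<open>l + n * \<tau>\<close> at which \<open>g\<close> reaches \<open>v\<close> will do.\<close>

lemma mono_threshold_crossing:
  fixes g :: "real \<Rightarrow> real"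
  assumes "mono g" "g l < v" "v \<le> g u" "0 < \<tau>"
  obtains a where "g (a - \<tau>) < v" "v \<le> g a"
proof -
  obtain m :: nat where "u - l < m * \<tau>"
    using reals_Archimedean3[OF \<open>0 < \<tau>\<close>] by blast
  then have "g u \<le> g (l + m * \<tau>)"
    using \<open>mono g\<close> by (auto intro!: monoD[of g])
  then have ex: "v \<le> g (l + m * \<tau>)" using assms by simp
  define n where "n = (LEAST m :: nat. v \<le> g (l + m * \<tau>))"
  have n: "v \<le> g (l + n * \<tau>)" unfolding n_def using ex by (rule LeastI)
  then have "n \<noteq> 0" using assms by (intro notI) simp
  then obtain k where k: "n = Suc k" by (cases n) auto
  have "\<not> v \<le> g (l + k * \<tau>)"
    using not_less_Least[of k "\<lambda>m. v \<le> g (l + real m * \<tau>)"] k by (auto simp: n_def)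
  then have "g ((l + n * \<tau>) - \<tau>) < v" by (simp add: k algebra_simps)
  with n that show ?thesis by blast
qed

text \<open>Some point \<open>X s0\<close> is far from hardly any other value; measure angles \<open>\<theta>\<close> from it. Apart from a
  small set they lie in \<open>(- 2 * pi / 3, 2 * pi / 3)\<close>, so that two of them differ by less than
  \<open>4 * pi / 3\<close> and are far apart precisely when they differ by at least \<open>2 * pi / 3\<close>. If the lower and
  the upper quantile of order \<open>1 / 50\<close> differed by \<open>2 * pi / 3\<close> or more, each value below the first would be
  far from each value above the second, and that would be a mass of \<open>(h / 50)\<^sup>2\<close> of far pairs. Hence the
  quantiles are closer, and the direction in the middle between them defines the half plane. The
  exceptional set consists of the values far from \<open>X s0\<close> and of the two tails; its bound \<open>h / 20\<close> is
  the one needed for windows cut into quarters.\<close>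

lemma (in finite_measure) few_far_pairs_imp_half_plane:
  fixes X :: "'a \<Rightarrow> complex" and h :: real
  assumes X [measurable]: "X \<in> borel_measurable M"
    and unit: "\<And>t. t \<in> space M \<Longrightarrow> cmod (X t) = 1"
    and h: "measure M (space M) = h" "0 < h"
    and few: "(\<integral>\<^sup>+ s. emeasure M {t \<in> space M. sqrt 3 \<le> cmod (X s - X t)} \<partial>M) < ennreal (h\<^sup>2 / 2500)"
  obtains e B where "cmod e = 1" "B \<in> sets M" "measure M B < h / 20"
    "\<And>t. t \<in> space M - B \<Longrightarrow> 1 / 4 \<le> Re (e * X t)"
proof -
  define far where "far s = {t \<in> space M. sqrt 3 \<le> cmod (X s - X t)}" for s
  have [measurable]: "far s \<in> sets M" for s unfolding far_def by measurable
  obtain s0 where s0: "s0 \<in> space M" "measure M (far s0) < h / 2500"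
  proof (rule ccontr)
    assume "\<not> thesis"
    with that have "\<And>s. s \<in> space M \<Longrightarrow> h / 2500 \<le> measure M (far s)" by force
    then have "(\<integral>\<^sup>+ s. ennreal (h / 2500) \<partial>M) \<le> (\<integral>\<^sup>+ s. emeasure M (far s) \<partial>M)"
      by (intro nn_integral_mono) (auto simp: emeasure_eq_measure)
    also have "\<dots> < ennreal (h\<^sup>2 / 2500)" using few by (simp add: far_def)
    also have "(\<integral>\<^sup>+ s. ennreal (h / 2500) \<partial>M) = ennreal (h\<^sup>2 / 2500)"
      using h by (simp add: emeasure_eq_measure ennreal_mult'[symmetric] power2_eq_square)
    finally show False by simp
  qed
  have X0: "cmod (X s0) = 1" using unit s0 by simp
  define \<theta> where "\<theta> t = Arg (X t / X s0)" for t
  have [measurable]: "\<theta> \<in> borel_measurable M" unfolding \<theta>_def by measurable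
  have Xcis: "X t = X s0 * cis (\<theta> t)" if "t \<in> space M" for t
  proof -
    have "X t / X s0 \<noteq> 0" using unit[OF that] X0 by force
    then have "cis (\<theta> t) = sgn (X t / X s0)" by (simp add: \<theta>_def cis_Arg)
    also have "\<dots> = X t / X s0" using unit[OF that] X0 by (simp add: sgn_div_norm norm_divide)
    finally show ?thesis using X0 by force
  qed
  have dist: "cmod (X s - X t) = cmod (cis (\<theta> s) - cis (\<theta> t))" if "s \<in> space M" "t \<in> space M" for s t
    unfolding Xcis[OF that(1)] Xcis[OF that(2)] right_diff_distrib[symmetric] norm_mult X0 by simp
  define G where "G = space M - far s0"
  have G [measurable]: "G \<in> sets M" unfolding G_def by measurable
  have G_space: "t \<in> space M" if "t \<in> G" for t using that by (simp add: G_def)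
  have range: "\<bar>\<theta> t\<bar> < 2 * pi / 3" if "t \<in> G" for t
  proof (rule abs_less_of_cos_greater)
    have "\<theta> s0 = 0" using X0 by (auto simp: \<theta>_def)
    moreover have "\<not> sqrt 3 \<le> cmod (X s0 - X t)"
      using that by (auto simp: G_def far_def)
    ultimately show "- 1 / 2 < cos (\<theta> t)"
      using dist[of s0 t] far_cis_iff[of 0 "\<theta> t"] s0 G_space[OF that] by auto
    show "\<bar>\<theta> t\<bar> \<le> pi" using Arg_bounded[of "X t / X s0"] by (auto simp: \<theta>_def abs_if)
  qed
  define lo where "lo x = measure M {t \<in> space M. t \<in> G \<and> \<theta> t \<le> x}" for x
  define up where "up x = measure M {t \<in> space M. t \<in> G \<and> - \<theta> t \<le> x}" for x
  have G_mass: "measure M G \<ge> h - h / 2500"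
    using s0 h unfolding G_def by (simp add: finite_measure_compl)
  have lo_mono: "mono lo" and up_mono: "mono up"
    unfolding lo_def up_def by (intro monoI finite_measure_mono; auto)+
  have empty: "{t \<in> space M. t \<in> G \<and> \<theta> t \<le> - pi} = {}" "{t \<in> space M. t \<in> G \<and> - \<theta> t \<le> - pi} = {}"
    using range pi_gt_zero by force+
  have full: "{t \<in> space M. t \<in> G \<and> \<theta> t \<le> pi} = G" "{t \<in> space M. t \<in> G \<and> - \<theta> t \<le> pi} = G"
    using range pi_gt_zero G_space by force+
  have ends: "lo (- pi) < h / 50" "h / 50 \<le> lo pi" "up (- pi) < h / 50" "h / 50 \<le> up pi"
    using G_mass h unfolding lo_def up_def empty full by auto
  \<comment> \<open>The quantiles are \<open>a\<close> and \<open>- b\<close>; the upper tail is the lower tail of \<open>- \<theta>\<close>.\<close>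
  obtain a where a: "lo (a - 1 / 4) < h / 50" "h / 50 \<le> lo a"
    using mono_threshold_crossing[OF lo_mono ends(1,2), of "1 / 4"] by auto
  obtain b where b: "up (b - 1 / 4) < h / 50" "h / 50 \<le> up b"
    using mono_threshold_crossing[OF up_mono ends(3,4), of "1 / 4"] by auto
  have gap: "- b - a < 2 * pi / 3"
  proof (rule ccontr)
    assume "\<not> ?thesis"
    then have ab: "2 * pi / 3 \<le> - b - a" by simp
    define L where "L = {t \<in> space M. t \<in> G \<and> \<theta> t \<le> a}"
    define U where "U = {t \<in> space M. t \<in> G \<and> - \<theta> t \<le> b}"
    have [measurable]: "L \<in> sets M" "U \<in> sets M" unfolding L_def U_def by measurable
    have sub: "U \<subseteq> far s" if "s \<in> L" for s
    proof
      fix t assume "t \<in> U"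
      with that have *: "s \<in> space M" "t \<in> space M" "s \<in> G" "t \<in> G" "\<theta> s \<le> a" "- \<theta> t \<le> b"
        by (auto simp: L_def U_def)
      have "cos (\<theta> t - \<theta> s) \<le> - 1 / 2"
        using * ab range[of s] range[of t] by (intro cos_le_minus_half) auto
      then have "sqrt 3 \<le> cmod (cis (\<theta> t) - cis (\<theta> s))" by (simp add: far_cis_iff)
      then show "t \<in> far s" using * dist[of s t] by (simp add: far_def norm_minus_commute)
    qed
    have "ennreal (h / 50 * (h / 50)) \<le> ennreal (measure M U * measure M L)"
      using a b h by (intro ennreal_leI mult_mono) (auto simp: lo_def up_def L_def U_def)
    also have "\<dots> = (\<integral>\<^sup>+ s. ennreal (measure M U) * indicator L s \<partial>M)"
      by (simp add: nn_integral_cmult_indicator emeasure_eq_measure ennreal_mult)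
    also have "\<dots> \<le> (\<integral>\<^sup>+ s. emeasure M (far s) \<partial>M)"
      using sub by (intro nn_integral_mono)
        (auto simp: emeasure_eq_measure finite_measure_mono split: split_indicator)
    also have "\<dots> < ennreal (h\<^sup>2 / 2500)" using few by (simp add: far_def)
    finally show False by (simp add: power2_eq_square)
  qed
  define c where "c = (a - b) / 2"
  define BL where "BL = {t \<in> space M. t \<in> G \<and> \<theta> t \<le> a - 1 / 4}"
  define BU where "BU = {t \<in> space M. t \<in> G \<and> - \<theta> t \<le> b - 1 / 4}"
  have [measurable]: "BL \<in> sets M" "BU \<in> sets M" unfolding BL_def BU_def by measurable
  show thesis
  proof (rule that[of "cis (- c) / X s0" "far s0 \<union> (BL \<union> BU)"])
    show "cmod (cis (- c) / X s0) = 1" using X0 by (simp add: norm_divide)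
    show "far s0 \<union> (BL \<union> BU) \<in> sets M" by measurable
    have "measure M (far s0 \<union> (BL \<union> BU)) \<le> measure M (far s0) + (measure M BL + measure M BU)"
      by (intro order.trans[OF measure_Un_le] add_left_mono measure_Un_le)
        measurable
    also have "\<dots> < h / 2500 + (h / 50 + h / 50)"
      using s0 a b by (intro add_strict_mono) (auto simp: lo_def up_def BL_def BU_def)
    also have "\<dots> < h / 20" using h by simp
    finally show "measure M (far s0 \<union> (BL \<union> BU)) < h / 20" .
    fix t assume t: "t \<in> space M - (far s0 \<union> (BL \<union> BU))"
    then have tt: "t \<in> space M" "t \<in> G" "a - 1 / 4 < \<theta> t" "\<theta> t < - b + 1 / 4"
      by (auto simp: G_def BL_def BU_def)
    have "cis (- c) / X s0 * X t = cis (\<theta> t - c)"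
      using X0 by (subst Xcis) (auto simp: tt cis_mult)
    moreover have "cos (\<theta> t - c) \<ge> 1 / 4"
      using tt gap by (intro cos_ge_quarter) (auto simp: c_def abs_if field_simps)
    ultimately show "1 / 4 \<le> Re (cis (- c) / X s0 * X t)" by simp
  qed
qed

section \<open>Integrals in a half plane, and angles\<close>

text \<open>The values outside \<open>B\<close> contribute at least \<open>1 / 4\<close> per unit of mass and those in \<open>B\<close> at least
  \<open>- 1\<close>, so the factor \<open>5\<close> makes the former prevail.\<close>

lemma (in finite_measure) Re_set_integral_pos:
  fixes X :: "'a \<Rightarrow> complex"
  assumes X [measurable]: "X \<in> borel_measurable M"
    and unit: "\<And>t. t \<in> space M \<Longrightarrow> cmod (X t) = 1"
    and e: "cmod e = 1"
    and BQ [measurable]: "B \<in> sets M" "Q \<in> sets M"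
    and pos: "\<And>t. t \<in> Q - B \<Longrightarrow> 1 / 4 \<le> Re (e * X t)"
    and small: "5 * measure M B < measure M Q"
  shows "0 < Re (e * (LINT t:Q|M. X t))"
proof -
  have Q: "t \<in> space M" if "t \<in> Q" for t using sets.sets_into_space[OF BQ(2)] that by auto
  have int: "integrable M (\<lambda>t. indicator Q t *\<^sub>R (e * X t))"
    using Q unit e by (intro integrable_const_bound[where B = 1] AE_I2)
      (auto simp: norm_mult split: split_indicator)
  have lower: "indicator Q t / 4 - 5 / 4 * indicator B t \<le> Re (indicator Q t *\<^sub>R (e * X t))"
    if "t \<in> space M" for t
  proof -
    have "\<bar>Re (e * X t)\<bar> \<le> 1"
      using abs_Re_le_cmod[of "e * X t"] unit[OF that] e by (simp add: norm_mult)
    then show ?thesis using pos[of t] by (cases "t \<in> Q"; cases "t \<in> B") auto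
  qed
  have "0 < measure M Q / 4 - 5 / 4 * measure M B" using small by simp
  also have "\<dots> = (LINT t|M. indicator Q t / 4 - 5 / 4 * indicator B t)"
    using Q by (subst Bochner_Integration.integral_diff)
      (auto intro!: integrable_real_indicator simp: Int_absorb1 emeasure_eq_measure less_top[symmetric])
  also have "\<dots> \<le> (LINT t|M. Re (indicator Q t *\<^sub>R (e * X t)))"
    by (intro integral_mono integrable_Re[OF int] lower)
      (auto intro!: integrable_real_indicator simp: emeasure_eq_measure less_top[symmetric])
  also have "\<dots> = Re (LINT t|M. indicator Q t *\<^sub>R (e * X t))"
    using int by (rule integral_Re)
  also have "(LINT t|M. indicator Q t *\<^sub>R (e * X t)) = e * (LINT t:Q|M. X t)"
    by (simp add: set_lebesgue_integral_def flip: integral_mult_right_zero)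
  finally show ?thesis .
qed

text \<open>The angle of the side from \<open>a\<close> to \<open>b\<close> as seen from the origin. It is total: when the side passes
  through the origin its value is a mere convention, which is harmless because the turns of such
  sides either cancel or are only estimated by \<open>pi\<close>.\<close>

definition turn :: "complex \<Rightarrow> complex \<Rightarrow> real"
  where "turn a b = Arg (b / a)"

lemma abs_turn_le: "\<bar>turn a b\<bar> \<le> pi"
  using Arg_bounded[of "b / a"] by (auto simp: turn_def)

text \<open>Inside a half plane the argument is a potential for \<open>turn\<close>, so turns add up to zero along closed
  polygons.\<close>

lemma turn_in_half_plane:
  assumes "0 < Re (e * a)" "0 < Re (e * b)"
  shows "turn a b = Arg (e * b) - Arg (e * a)"
proof -
  have nz: "e * a \<noteq> 0" "e * b \<noteq> 0" using assms by (metis less_irrefl zero_complex.sel(1))+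
  have "\<bar>Arg (e * a)\<bar> < pi / 2" "\<bar>Arg (e * b)\<bar> < pi / 2"
    using assms Arg_Re_pos by blast+
  then have "Arg ((e * b) / (e * a)) = Arg (e * b) - Arg (e * a)"
    using Arg_divide[OF nz] nz
    by (intro Arg_unique_lemma[of "(e * b) / (e * a)" "Arg (e * b) - Arg (e * a)"] is_Arg_Arg)
       (auto simp: mpi_less_Arg Arg_le_pi simp del: mult_divide_mult_cancel_left_if)
  then show ?thesis using nz by (simp add: turn_def)
qed

lemma turn_cis:
  assumes "\<bar>y - x\<bar> < pi"
  shows "turn (cis x) (cis y) = y - x"
  using assms unfolding turn_def cis_divide by (intro Arg_cis) auto

section \<open>Sums over dyadic scales and two periods\<close>

lemma sum_lessThan_double: "(\<Sum>i<2 * (k::nat). g i) = (\<Sum>i<k. g (2 * i) + g (2 * i + 1))"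
  for g :: "nat \<Rightarrow> 'a :: comm_monoid_add"
  by (induction k) (auto simp: add.assoc)

lemma nn_integral_two_periods:
  fixes g :: "real \<Rightarrow> ennreal"
  assumes [measurable]: "g \<in> borel_measurable borel" and per: "\<And>t. g (t + p) = g t" and "0 \<le> p"
  shows "(\<integral>\<^sup>+ t. indicator {0..<2 * p} t * g t \<partial>lborel)
    = 2 * (\<integral>\<^sup>+ t. indicator {0..<p} t * g t \<partial>lborel)"
proof -
  have "(\<integral>\<^sup>+ t. indicator {0..<2 * p} t * g t \<partial>lborel)
    = (\<integral>\<^sup>+ t. indicator {0..<p} t * g t + indicator {p..<2 * p} t * g t \<partial>lborel)"
    using \<open>0 \<le> p\<close> by (intro nn_integral_cong) (auto split: split_indicator)
  also have "\<dots> = (\<integral>\<^sup>+ t. indicator {0..<p} t * g t \<partial>lborel)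
      + (\<integral>\<^sup>+ t. indicator {p..<2 * p} t * g t \<partial>lborel)"
    by (intro nn_integral_add) auto
  also have "(\<integral>\<^sup>+ t. indicator {p..<2 * p} t * g t \<partial>lborel)
      = (\<integral>\<^sup>+ t. indicator {p..<2 * p} (p + 1 * t) * g (p + 1 * t) \<partial>lborel)"
    by (subst nn_integral_real_affine[where c = 1 and t = p]) auto
  also have "\<dots> = (\<integral>\<^sup>+ t. indicator {0..<p} t * g t \<partial>lborel)"
  proof (intro nn_integral_cong)
    fix t
    have "g (p + 1 * t) = g t" using per[of t] by (metis add.commute mult_1)
    then show "indicator {p..<2 * p} (p + 1 * t) * g (p + 1 * t) = indicator {0..<p} t * g t"
      by (simp only:) (simp split: split_indicator)
  qed
  finally show ?thesis by (simp only: mult_2)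
qed

text \<open>The terms grow geometrically in \<open>n\<close>, so the sum is controlled by the last scale \<open>4 * pi / 2 ^ n\<close>
  that still exceeds \<open>d\<close>. That is why the induction step forgets the earlier conditions as soon as
  the newest term counts.\<close>

lemma sum_dyadic_scales:
  fixes d :: real
  assumes "0 < d"
  shows "(\<Sum>n<N. if d < 4 * pi / 2 ^ n then (2 ^ n / (4 * pi))\<^sup>2 else 0) \<le> 4 / 3 / d\<^sup>2"
proof (induction N)
  case (Suc N)
  show ?case
  proof (cases "d < 4 * pi / 2 ^ N")
    case True
    have "(\<Sum>n<Suc N. if d < 4 * pi / 2 ^ n then (2 ^ n / (4 * pi))\<^sup>2 else 0)
        \<le> (\<Sum>n<Suc N. (2 ^ n / (4 * pi))\<^sup>2)"
      by (intro sum_mono) auto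
    also have "\<dots> \<le> 4 / 3 * (2 ^ N / (4 * pi))\<^sup>2"
    proof -
      have "3 * (\<Sum>n<Suc N. (c ^ n)) \<le> 4 * c ^ N" if "c = (4 :: real)" for c N
        using that by (induction N) auto
      from this[OF refl, of N] have "(\<Sum>n<Suc N. 4 ^ n) \<le> 4 / 3 * (4 :: real) ^ N"
        by linarith
      moreover have "(2 ^ n / (4 * pi))\<^sup>2 = 4 ^ n / (4 * pi)\<^sup>2" for n
        by (simp add: power_divide power2_eq_square flip: power_mult_distrib)
      ultimately show ?thesis
        using divide_right_mono[of "\<Sum>n<Suc N. 4 ^ n" "4 / 3 * (4 :: real) ^ N" "(4 * pi)\<^sup>2"]
        by (simp only: sum_divide_distrib[symmetric] times_divide_eq_right) simp
    qed
    also have "\<dots> \<le> 4 / 3 * (1 / d)\<^sup>2"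
      using True assms by (intro mult_left_mono power_mono) (auto simp: field_simps)
    finally show ?thesis by (simp add: power_divide)
  qed (use Suc in simp)
qed (use assms in simp)

text \<open>Windows of width \<open>2 * \<tau>\<close> shifted by \<open>\<tau>\<close>: the only ones that can contain \<open>s\<close> are the one starting
  at the last grid point up to \<open>s\<close> and its predecessor.\<close>

lemma card_windows_containing:
  fixes \<tau> s :: real and m :: nat
  assumes "0 < \<tau>"
  shows "card {i \<in> {..<m}. s \<in> {real i * \<tau> ..< (real i + 2) * \<tau>}} \<le> 2"
proof -
  have "{i \<in> {..<m}. s \<in> {real i * \<tau> ..< (real i + 2) * \<tau>}} \<subseteq> {nat \<lfloor>s / \<tau>\<rfloor> - 1, nat \<lfloor>s / \<tau>\<rfloor>}"
  proof
    fix i assume i: "i \<in> {i \<in> {..<m}. s \<in> {real i * \<tau> ..< (real i + 2) * \<tau>}}"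
    then have "real i \<le> s / \<tau>" "s / \<tau> < real i + 2" using assms by (auto simp: field_simps)
    then have "int i \<le> \<lfloor>s / \<tau>\<rfloor>" "\<lfloor>s / \<tau>\<rfloor> < int i + 2" by linarith+
    then show "i \<in> {nat \<lfloor>s / \<tau>\<rfloor> - 1, nat \<lfloor>s / \<tau>\<rfloor>}" by auto
  qed
  then have "card {i \<in> {..<m}. s \<in> {real i * \<tau> ..< (real i + 2) * \<tau>}}
      \<le> card {nat \<lfloor>s / \<tau>\<rfloor> - 1, nat \<lfloor>s / \<tau>\<rfloor>}"
    by (intro card_mono) auto
  also have "\<dots> \<le> 2" by (simp add: card_insert_le_m1)
  finally show ?thesis .
qed

lemma cmod_cis_diff_le: "cmod (cis s - cis t) \<le> \<bar>s - t\<bar>"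
proof -
  have "(cmod (cis s - cis t))\<^sup>2 \<le> (s - t)\<^sup>2"
  proof -
    have "cos (s - t) = 1 - 2 * (sin ((s - t) / 2))\<^sup>2"
      using cos_double_sin[of "(s - t) / 2"] by (simp only: mult_2 field_sum_of_halves)
    moreover have "(sin ((s - t) / 2))\<^sup>2 \<le> ((s - t) / 2)\<^sup>2"
      using abs_sin_x_le_abs_x[of "(s - t) / 2"] by (simp only: abs_le_square_iff)
    ultimately show ?thesis by (simp add: cmod_cis_diff_sq power_divide)
  qed
  then show ?thesis by (metis abs_ge_zero power2_abs power2_le_imp_le)
qed

section \<open>Arc integrals of a periodic curve on the circle\<close>

definition far_ind :: "(real \<Rightarrow> complex) \<Rightarrow> real \<Rightarrow> real \<Rightarrow> ennreal"
  where "far_ind F s t = (if sqrt 3 \<le> cmod (F s - F t) then 1 else 0)"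

lemma measurable_far_ind [measurable]:
  assumes [measurable]: "F \<in> borel_measurable borel"
  shows "(\<lambda>x. far_ind F (fst x) (snd x)) \<in> borel_measurable (borel \<Otimes>\<^sub>M borel)"
    "far_ind F s \<in> borel_measurable borel"
  unfolding far_ind_def by measurable

text \<open>The curve is \<open>F t = g (cis t)\<close> for a continuous map \<open>g\<close> of the circle; working on the real line turns
  arcs into intervals, even those across the base point. The last assumption expresses
  periodicity in the form that excludes far values over one and the same point of the circle, where the kernel \<open>1 / \<bar>x - y\<bar>\<^sup>2\<close> degenerates.\<close>

locale periodic_unit_curve =
  fixes F :: "real \<Rightarrow> complex"
  assumes cont: "continuous_on UNIV F"
    and unit: "cmod (F t) = 1"
    and factors: "cis s = cis t \<Longrightarrow> F s = F t"
begin

lemma periodic: "F (t + 2 * pi) = F t"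
  by (rule factors) (simp flip: cis_mult)

lemma F_measurable [measurable]: "F \<in> borel_measurable borel"
  using cont by (rule borel_measurable_continuous_onI)

text \<open>Integrals are not divided by the length, since only their arguments will matter.\<close>

definition arc_integral :: "real \<Rightarrow> real \<Rightarrow> complex"
  where "arc_integral x y = (LINT t:{x..<y}|lborel. F t)"

lemma arc_integral_shift: "arc_integral (x + 2 * pi) (y + 2 * pi) = arc_integral x y"
proof -
  have "arc_integral (x + 2 * pi) (y + 2 * pi)
      = (LINT t|lborel. indicator {x + 2 * pi..<y + 2 * pi} (2 * pi + 1 * t) *\<^sub>R F (2 * pi + 1 * t))"
    unfolding arc_integral_def set_lebesgue_integral_def
    by (subst lborel_integral_real_affine[where c = 1 and t = "2 * pi"]) auto
  also have "\<dots> = arc_integral x y"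
    unfolding arc_integral_def set_lebesgue_integral_def
  proof (intro Bochner_Integration.integral_cong refl)
    fix t
    have "F (2 * pi + 1 * t) = F t" using periodic[of t] by (metis add.commute mult_1)
    then show "indicat_real {x + 2 * pi..<y + 2 * pi} (2 * pi + 1 * t) *\<^sub>R F (2 * pi + 1 * t)
        = indicat_real {x..<y} t *\<^sub>R F t"
      by (simp only:) (simp split: split_indicator)
  qed
  finally show ?thesis .
qed

lemma arc_integral_in_half_plane:
  fixes a h :: real and A :: "real set"
  defines "A \<equiv> {a..<a + h}"
  assumes h: "0 < h" and e: "cmod e = 1"
    and B: "B \<in> sets (restrict_space lborel A)" "measure (restrict_space lborel A) B < h / 20"
    and pos: "\<And>t. t \<in> A - B \<Longrightarrow> 1 / 4 \<le> Re (e * F t)"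
    and xy: "a \<le> x" "y \<le> a + h" "h / 4 \<le> y - x"
  shows "0 < Re (e * arc_integral x y)"
proof -
  interpret finite_measure "restrict_space lborel A"
    using h by (intro finite_measureI) (auto simp: A_def space_restrict_space emeasure_restrict_space)
  have sub: "{x..<y} \<subseteq> A" using xy by (auto simp: A_def)
  have A: "A \<in> sets lborel" "space (restrict_space lborel A) = A"
    by (auto simp: A_def space_restrict_space)
  have "0 < Re (e * (LINT t:{x..<y}|restrict_space lborel A. F t))"
  proof (rule Re_set_integral_pos[where B = B])
    show "F \<in> borel_measurable (restrict_space lborel A)"
      by (intro measurable_restrict_space1) measurable
    show "{x..<y} \<in> sets (restrict_space lborel A)"
      using sub A by (auto simp: sets_restrict_space_iff)
    have "measure (restrict_space lborel A) {x..<y} = y - x"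
      using sub A xy h by (subst measure_restrict_space) auto
    then show "5 * measure (restrict_space lborel A) B < measure (restrict_space lborel A) {x..<y}"
      using B xy by simp
  qed (use A sub unit e B pos in auto)
  also have "(LINT t:{x..<y}|restrict_space lborel A. F t) = arc_integral x y"
    unfolding arc_integral_def using A sub
    by (subst set_integral_restrict_space)
      (auto simp: set_lebesgue_integral_def intro!: Bochner_Integration.integral_cong split: split_indicator)
  finally show ?thesis .
qed

definition far_mass :: "real \<Rightarrow> real \<Rightarrow> ennreal"
  where "far_mass x y = (\<integral>\<^sup>+ s. \<integral>\<^sup>+ t. indicator {x..<y} s * indicator {x..<y} t * far_ind F s t \<partial>lborel \<partial>lborel)"

text \<open>One half plane serves all subarcs that are at least a quarter of the window: each of them has five
  times the mass of the exceptional set.\<close>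

lemma arc_integrals_share_half_plane:
  assumes h: "0 < h" and few: "far_mass a (a + h) < ennreal (h\<^sup>2 / 2500)"
  obtains e where "\<And>x y. a \<le> x \<Longrightarrow> y \<le> a + h \<Longrightarrow> h / 4 \<le> y - x \<Longrightarrow> 0 < Re (e * arc_integral x y)"
proof -
  define A where "A = {a..<a + h}"
  let ?M = "restrict_space lborel A"
  interpret finite_measure ?M
    using h by (intro finite_measureI) (auto simp: A_def space_restrict_space emeasure_restrict_space)
  have A: "A \<in> sets lborel" "space ?M = A"
    by (auto simp: A_def space_restrict_space)
  have em: "emeasure ?M {t \<in> A. sqrt 3 \<le> cmod (F s - F t)}
      = (\<integral>\<^sup>+ t. indicator A t * far_ind F s t \<partial>lborel)" for s
  proof -
    have "{t \<in> A. sqrt 3 \<le> cmod (F s - F t)} = A \<inter> {t \<in> space borel. sqrt 3 \<le> cmod (F s - F t)}"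
      by auto
    also have "\<dots> \<in> sets lborel" using A by (intro sets.Int) (auto simp: A_def)
    finally have [measurable]: "{t \<in> A. sqrt 3 \<le> cmod (F s - F t)} \<in> sets lborel" .
    have "emeasure ?M {t \<in> A. sqrt 3 \<le> cmod (F s - F t)}
        = emeasure lborel {t \<in> A. sqrt 3 \<le> cmod (F s - F t)}"
      using A by (intro emeasure_restrict_space) auto
    also have "\<dots> = (\<integral>\<^sup>+ t. indicator {t \<in> A. sqrt 3 \<le> cmod (F s - F t)} t \<partial>lborel)"
      by (rule nn_integral_indicator[symmetric]) measurable
    also have "\<dots> = (\<integral>\<^sup>+ t. indicator A t * far_ind F s t \<partial>lborel)"
      by (intro nn_integral_cong) (auto simp: far_ind_def split: split_indicator)
    finally show ?thesis .
  qed
  have "(\<integral>\<^sup>+ s. emeasure ?M {t \<in> space ?M. sqrt 3 \<le> cmod (F s - F t)} \<partial>?M) = far_mass a (a + h)"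
    using A unfolding A(2) em far_mass_def
    by (simp add: nn_integral_restrict_space nn_integral_cmult[symmetric] A_def mult_ac
        flip: A_def)
  with few have few': "(\<integral>\<^sup>+ s. emeasure ?M {t \<in> space ?M. sqrt 3 \<le> cmod (F s - F t)} \<partial>?M)
      < ennreal (h\<^sup>2 / 2500)" by simp
  have F: "F \<in> borel_measurable ?M" by (intro measurable_restrict_space1) measurable
  have "measure ?M (space ?M) = h"
    using A h by (simp add: measure_restrict_space) (simp add: A_def)
  from few_far_pairs_imp_half_plane[OF F unit this h few'] obtain e B
    where eB: "cmod e = 1" "B \<in> sets ?M" "measure ?M B < h / 20"
      "\<And>t. t \<in> space ?M - B \<Longrightarrow> 1 / 4 \<le> Re (e * F t)"
    by blast
  show thesis
    using arc_integral_in_half_plane[OF h eB(1), of B a] eB A that[of e] by (auto simp: A_def)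
qed

section \<open>The polygons of dyadic arc integrals\<close>

definition node :: "nat \<Rightarrow> nat \<Rightarrow> real"
  where "node n i = real i * (2 * pi / 2 ^ n)"

definition vertex :: "nat \<Rightarrow> nat \<Rightarrow> complex"
  where "vertex n i = arc_integral (node n i) (node n (Suc i))"

definition level_turn :: "nat \<Rightarrow> real"
  where "level_turn n = (\<Sum>i<2 ^ n. turn (vertex n i) (vertex n (Suc i)))"

text \<open>The turn around the pentagon with vertices the integrals over the arcs \<open>i\<close> and \<open>i + 1\<close> of level \<open>n\<close>,
  the left half of arc \<open>i + 1\<close>, and the right and left halves of arc \<open>i\<close>. Sides traversed backwards
  are written with a minus sign rather than with exchanged end points, since \<open>turn\<close> fails to be
  antisymmetric on sides through the origin.\<close>

definition charge :: "nat \<Rightarrow> nat \<Rightarrow> real"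
  where "charge n i =
    turn (vertex n i) (vertex n (Suc i)) + turn (vertex n (Suc i)) (vertex (Suc n) (2 * i + 2))
    - turn (vertex (Suc n) (2 * i + 1)) (vertex (Suc n) (2 * i + 2))
    - turn (vertex (Suc n) (2 * i)) (vertex (Suc n) (2 * i + 1))
    - turn (vertex n i) (vertex (Suc n) (2 * i))"

lemma node_wrap: "node n (i + 2 ^ n) = node n i + 2 * pi"
  by (simp add: node_def field_simps)

lemma vertex_wrap: "vertex n (i + 2 ^ n) = vertex n i"
  using node_wrap[of n i] node_wrap[of n "Suc i"] by (simp add: vertex_def arc_integral_shift)

lemma vertex_last: "vertex n (2 ^ n) = vertex n 0"
  using vertex_wrap[of n 0] by simp

lemma level_turn_0: "level_turn 0 = 0"
  using vertex_last[of 0] by (simp add: level_turn_def turn_def Arg_zero divide_self_if)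

text \<open>The sides joining an arc to its left half are shared by consecutive pentagons and cancel around the
  circle, which leaves one polygon of level \<open>n\<close> and one of level \<open>n + 1\<close>.\<close>

lemma level_turn_diff: "level_turn n - level_turn (Suc n) = (\<Sum>i<2 ^ n. charge n i)"
proof -
  define v where "v i = turn (vertex n i) (vertex (Suc n) (2 * i))" for i
  have "(\<Sum>i<2 ^ n. v (Suc i) - v i) = v (2 ^ n) - v 0"
    by (rule sum_lessThan_telescope)
  also have "v (2 ^ n) = v 0"
    using vertex_last[of n] vertex_last[of "Suc n"] by (simp add: v_def)
  finally have "(\<Sum>i<2 ^ n. v (Suc i) - v i) = 0" by simp
  moreover have "level_turn (Suc n) = (\<Sum>i<2 ^ n.
      turn (vertex (Suc n) (2 * i)) (vertex (Suc n) (2 * i + 1)) +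
      turn (vertex (Suc n) (2 * i + 1)) (vertex (Suc n) (2 * i + 2)))"
    unfolding level_turn_def power_Suc sum_lessThan_double by simp
  moreover have "(\<Sum>i<2 ^ n. charge n i) = level_turn n + (\<Sum>i<2 ^ n. v (Suc i) - v i)
      - (\<Sum>i<2 ^ n. turn (vertex (Suc n) (2 * i)) (vertex (Suc n) (2 * i + 1)) +
          turn (vertex (Suc n) (2 * i + 1)) (vertex (Suc n) (2 * i + 2)))"
    unfolding level_turn_def sum.distrib[symmetric] sum_subtractf[symmetric]
    by (intro sum.cong) (auto simp: charge_def v_def)
  ultimately show ?thesis by simp
qed

lemma abs_charge_le: "\<bar>charge n i\<bar> \<le> 5 * pi"
  using abs_turn_le[of "vertex n i" "vertex n (Suc i)"] abs_turn_le[of "vertex n (Suc i)" "vertex (Suc n) (2 * i + 2)"]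
    abs_turn_le[of "vertex (Suc n) (2 * i + 1)" "vertex (Suc n) (2 * i + 2)"]
    abs_turn_le[of "vertex (Suc n) (2 * i)" "vertex (Suc n) (2 * i + 1)"]
    abs_turn_le[of "vertex n i" "vertex (Suc n) (2 * i)"]
  unfolding charge_def by linarith

text \<open>All five arcs have length at least a quarter of the window \<open>h = 4 * pi / 2 ^ n\<close>. The constant is
  \<open>12500 * pi = 5 * pi * 2500\<close>.\<close>

lemma charge_le_far_mass:
  "ennreal \<bar>charge n i\<bar> \<le>
    ennreal (12500 * pi * (2 ^ n / (4 * pi))\<^sup>2) * far_mass (node n i) (node n (i + 2))"
proof -
  define h where "h = 4 * pi / 2 ^ n"
  have h: "0 < h" "node n (i + 2) = node n i + h" by (auto simp: h_def node_def field_simps)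
  show ?thesis
  proof (cases "far_mass (node n i) (node n i + h) < ennreal (h\<^sup>2 / 2500)")
    case True
    from arc_integrals_share_half_plane[OF h(1) True] obtain e
      where e: "\<And>x y. node n i \<le> x \<Longrightarrow> y \<le> node n i + h \<Longrightarrow> h / 4 \<le> y - x \<Longrightarrow> 0 < Re (e * arc_integral x y)"
      by blast
    have pos: "0 < Re (e * vertex n i)" "0 < Re (e * vertex n (Suc i))" "0 < Re (e * vertex (Suc n) (2 * i))"
      "0 < Re (e * vertex (Suc n) (2 * i + 1))" "0 < Re (e * vertex (Suc n) (2 * i + 2))"
      unfolding vertex_def by (rule e; simp add: node_def h_def field_simps)+
    have "charge n i = 0"
      unfolding charge_def using pos by (simp add: turn_in_half_plane[where e = e])
    then show ?thesis by simp
  next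
    case False
    have "ennreal \<bar>charge n i\<bar> \<le> ennreal (12500 * pi * (1 / h)\<^sup>2 * (h\<^sup>2 / 2500))"
      using abs_charge_le[of n i] h by (intro ennreal_leI) (simp add: power_divide)
    also have "\<dots> = ennreal (12500 * pi * (1 / h)\<^sup>2) * ennreal (h\<^sup>2 / 2500)"
      by (intro ennreal_mult) auto
    also have "\<dots> \<le> ennreal (12500 * pi * (1 / h)\<^sup>2) * far_mass (node n i) (node n i + h)"
      using False by (intro mult_left_mono) auto
    finally show ?thesis by (simp only: h) (simp add: h_def)
  qed
qed

lemma abs_level_turn_le:
  "ennreal \<bar>level_turn N\<bar> \<le> (\<Sum>n<N. \<Sum>i<2 ^ n.
    ennreal (12500 * pi * (2 ^ n / (4 * pi))\<^sup>2) * far_mass (node n i) (node n (i + 2)))"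
proof -
  have "(\<Sum>n<N. \<Sum>i<2 ^ n. charge n i) = (\<Sum>n<N. level_turn n - level_turn (Suc n))"
    by (simp only: level_turn_diff)
  also have "\<dots> = - level_turn N"
    by (simp add: sum_lessThan_telescope' level_turn_0)
  finally have "\<bar>level_turn N\<bar> = \<bar>\<Sum>n<N. \<Sum>i<2 ^ n. charge n i\<bar>" by simp
  also have "\<dots> \<le> (\<Sum>n<N. \<Sum>i<2 ^ n. \<bar>charge n i\<bar>)"
    by (intro order.trans[OF sum_abs] sum_mono sum_abs)
  finally have "ennreal \<bar>level_turn N\<bar> \<le> ennreal (\<Sum>n<N. \<Sum>i<2 ^ n. \<bar>charge n i\<bar>)"
    by (rule ennreal_leI)
  also have "\<dots> = (\<Sum>n<N. \<Sum>i<2 ^ n. ennreal \<bar>charge n i\<bar>)"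
    by (simp add: sum_ennreal sum_nonneg)
  also have "\<dots> \<le> (\<Sum>n<N. \<Sum>i<2 ^ n.
    ennreal (12500 * pi * (2 ^ n / (4 * pi))\<^sup>2) * far_mass (node n i) (node n (i + 2)))"
    by (intro sum_mono charge_le_far_mass)
  finally show ?thesis .
qed

lemma Re_cnj_mult_unit:
  assumes "cmod a = 1" "cmod (b - a) < 1 / 2"
  shows "1 / 2 < Re (cnj a * b)"
proof -
  have "cnj a * b = 1 + cnj a * (b - a)"
    using assms by (simp add: algebra_simps complex_norm_square[symmetric] mult.commute[of a])
  moreover have "\<bar>Re (cnj a * (b - a))\<bar> < 1 / 2"
    using abs_Re_le_cmod[of "cnj a * (b - a)"] assms by (simp only: norm_mult complex_mod_cnj)
  ultimately show ?thesis by (simp only: plus_complex.sel one_complex.sel)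
qed

text \<open>At a level where \<open>F\<close> is nearly constant on every window, the quadrilateral formed by two consecutive
  integrals and the values of \<open>F\<close> at the left ends of their arcs lies in a half plane. So the integrals
  turn as much as the values of \<open>F\<close> at the nodes, up to differences that telescope around the circle.\<close>

lemma level_turn_eventually:
  assumes \<phi>: "continuous_on {0..2 * pi} \<phi>"
    and lift: "\<And>t. t \<in> {0..2 * pi} \<Longrightarrow> F t = cis (\<phi> t)"
  obtains N where "level_turn N = \<phi> (2 * pi) - \<phi> 0"
proof -
  have "uniformly_continuous_on {0..4 * pi} F"
    using cont by (intro compact_uniformly_continuous continuous_on_subset[OF cont]) auto
  then obtain d1 where d1: "0 < d1"
    "\<And>s t. s \<in> {0..4 * pi} \<Longrightarrow> t \<in> {0..4 * pi} \<Longrightarrow> \<bar>s - t\<bar> < d1 \<Longrightarrow> cmod (F s - F t) < 1 / 2"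
    unfolding uniformly_continuous_on_def dist_norm real_norm_def
    by (metis half_gt_zero_iff zero_less_one)
  have "uniformly_continuous_on {0..2 * pi} \<phi>"
    using \<phi> by (intro compact_uniformly_continuous) auto
  then obtain d2 where d2: "0 < d2"
    "\<And>s t. s \<in> {0..2 * pi} \<Longrightarrow> t \<in> {0..2 * pi} \<Longrightarrow> \<bar>s - t\<bar> < d2 \<Longrightarrow> \<bar>\<phi> s - \<phi> t\<bar> < pi"
    unfolding uniformly_continuous_on_def dist_norm real_norm_def
    by (metis pi_gt_zero)
  define d where "d = min d1 d2"
  have d: "0 < d" "d \<le> d1" "d \<le> d2" using d1 d2 by (auto simp: d_def)
  obtain N where N: "4 * pi / d < 2 ^ N"
    using real_arch_pow[of 2 "4 * pi / d"] by auto
  define h where "h = 4 * pi / 2 ^ N"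
  have "h < d" using N d by (simp add: h_def field_simps)
  then have h: "0 < h" "h < d1" "h < d2" using d by (auto simp: h_def)
  define x where "x = node N"
  have x: "x (Suc i) = x i + h / 2" "0 \<le> x i" "i < 2 ^ N \<Longrightarrow> x (Suc i) \<le> 2 * pi" for i
  proof -
    show "x (Suc i) = x i + h / 2" "0 \<le> x i" by (auto simp: x_def node_def h_def field_simps)
    assume "i < 2 ^ N"
    then have "Suc i \<le> 2 ^ N" by simp
    then have "real (Suc i) \<le> real (2 ^ N)" by (rule of_nat_mono)
    then have "real (Suc i) \<le> 2 ^ N" by simp
    then have "real (Suc i) * (2 * pi / 2 ^ N) \<le> 2 ^ N * (2 * pi / 2 ^ N)"
      by (intro mult_right_mono) auto
    then show "x (Suc i) \<le> 2 * pi" by (simp add: x_def node_def)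
  qed
  have h_le: "h \<le> 4 * pi" by (simp add: h_def divide_le_eq)
  have step: "turn (vertex N i) (vertex N (Suc i)) = (\<phi> (x (Suc i)) - \<phi> (x i))
      + (turn (F (x (Suc i))) (vertex N (Suc i)) - turn (F (x i)) (vertex N i))" if i: "i < 2 ^ N" for i
  proof -
    note xi = x(1,2)[of i] x(3)[OF i]
    define e where "e = cnj (F (x i))"
    have near: "1 / 2 < Re (e * F t)" if t: "t \<in> {x i..<x i + h}" for t
    proof -
      have "t \<le> 4 * pi" using t xi h_le by auto
      then have "cmod (F t - F (x i)) < 1 / 2"
        using t h xi by (intro d1) auto
      then show ?thesis unfolding e_def by (intro Re_cnj_mult_unit unit)
    qed
    have e1: "cmod e = 1" using unit by (simp add: e_def)
    have arc_integral: "0 < Re (e * arc_integral a b)" if "x i \<le> a" "b \<le> x i + h" "h / 4 \<le> b - a" for a b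
    proof (rule arc_integral_in_half_plane[OF h(1) e1 _ _ _ that, of "{}"])
      show "1 / 4 \<le> Re (e * F t)" if "t \<in> {x i..<x i + h} - {}" for t
      proof -
        have "1 / 2 < Re (e * F t)" using that by (intro near) simp
        then show ?thesis by linarith
      qed
    qed (use h in auto)
    have pos: "0 < Re (e * vertex N i)" "0 < Re (e * vertex N (Suc i))"
      unfolding vertex_def x_def[symmetric] by (rule arc_integral; use h xi x(1)[of "Suc i"] in linarith)+
    have "0 < Re (e * F (x i))" "0 < Re (e * F (x (Suc i)))"
      using near[of "x i"] near[of "x (Suc i)"] h xi by auto
    note turns = turn_in_half_plane[where e = e, OF this(1) this(2)]
      turn_in_half_plane[where e = e, OF this(1) pos(1)]
      turn_in_half_plane[where e = e, OF this(2) pos(2)] turn_in_half_plane[where e = e, OF pos]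
    have "turn (F (x i)) (F (x (Suc i))) = \<phi> (x (Suc i)) - \<phi> (x i)"
      using xi h lift[of "x i"] lift[of "x (Suc i)"] by (simp add: turn_cis d2)
    with turns show ?thesis by simp
  qed
  have "level_turn N = (\<Sum>i<2 ^ N. \<phi> (x (Suc i)) - \<phi> (x i))
      + (\<Sum>i<2 ^ N. turn (F (x (Suc i))) (vertex N (Suc i)) - turn (F (x i)) (vertex N i))"
    unfolding level_turn_def sum.distrib[symmetric] by (intro sum.cong refl step) simp
  also have "\<dots> = \<phi> (x (2 ^ N)) - \<phi> (x 0)
      + (turn (F (x (2 ^ N))) (vertex N (2 ^ N)) - turn (F (x 0)) (vertex N 0))"
    by (simp only: sum_lessThan_telescope[of "\<lambda>i. \<phi> (x i)"]
        sum_lessThan_telescope[of "\<lambda>i. turn (F (x i)) (vertex N i)"])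
  also have "\<dots> = \<phi> (2 * pi) - \<phi> 0"
    using periodic[of 0] vertex_last[of N] by (simp add: x_def node_def)
  finally show thesis by (rule that)
qed

section \<open>Summation over all windows\<close>

definition gap_kernel :: "real \<Rightarrow> real \<Rightarrow> ennreal"
  where "gap_kernel s t = far_ind F s t * ennreal (1 / (cmod (cis s - cis t))\<^sup>2)"

lemma measurable_gap_kernel [measurable]:
  "(\<lambda>x. gap_kernel (fst x) (snd x)) \<in> borel_measurable (borel \<Otimes>\<^sub>M borel)"
  "gap_kernel s \<in> borel_measurable borel"
proof -
  have [measurable]: "cis \<in> borel_measurable borel"
    by (intro borel_measurable_continuous_onI continuous_intros)
  show "(\<lambda>x. gap_kernel (fst x) (snd x)) \<in> borel_measurable (borel \<Otimes>\<^sub>M borel)"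
    "gap_kernel s \<in> borel_measurable borel"
    unfolding gap_kernel_def by measurable
qed

text \<open>Windows of the last arc of a level reach beyond \<open>2 * pi\<close>, hence the square over two periods.
  The factor \<open>8 / 3\<close> is \<open>2\<close> windows per scale times the \<open>4 / 3\<close> of \<open>sum_dyadic_scales\<close>.\<close>

lemma sum_windows_le_gap_kernel:
  assumes "0 \<le> c"
  shows "(\<Sum>n<N. \<Sum>i<2 ^ n. ennreal (c * (2 ^ n / (4 * pi))\<^sup>2) *
      (indicator {node n i..<node n (i + 2)} s * indicator {node n i..<node n (i + 2)} t * far_ind F s t))
    \<le> ennreal (8 / 3 * c) * (indicator {0..<4 * pi} s * indicator {0..<4 * pi} t * gap_kernel s t)"
    (is "?L \<le> ?R")
proof (cases "sqrt 3 \<le> cmod (F s - F t) \<and> s \<in> {0..<4 * pi} \<and> t \<in> {0..<4 * pi}")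
  case False
  have sub: "{node n i..<node n (i + 2)} \<subseteq> {0..<4 * pi}" if "i < 2 ^ n" for n i
  proof -
    have "real (Suc i) \<le> real (2 ^ n)" using that by (intro of_nat_mono) simp
    moreover have "real (2 ^ 0) \<le> real (2 ^ n)" by (intro of_nat_mono power_increasing) auto
    ultimately have "real (i + 2) \<le> 2 * 2 ^ n" by simp
    then have "real (i + 2) * (2 * pi / 2 ^ n) \<le> 2 * 2 ^ n * (2 * pi / 2 ^ n)"
      by (intro mult_right_mono) auto
    then have "node n (i + 2) \<le> 4 * pi" "0 \<le> node n i" by (auto simp: node_def)
    then show ?thesis by (intro subsetI) auto
  qed
  have "?L = 0"
  proof (intro sum.neutral ballI)
    fix n i assume "i \<in> {..<(2 :: nat) ^ n}"
    then have "i < 2 ^ n" by simp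
    with sub[OF this] False have "\<not> (s \<in> {node n i..<node n (i + 2)} \<and> t \<in> {node n i..<node n (i + 2)} \<and> sqrt 3 \<le> cmod (F s - F t))"
      by blast
    then show "ennreal (c * (2 ^ n / (4 * pi))\<^sup>2) *
        (indicator {node n i..<node n (i + 2)} s * indicator {node n i..<node n (i + 2)} t * far_ind F s t) = 0"
      by (auto simp: far_ind_def simp del: atLeastLessThan_iff split: split_indicator)
  qed
  then show ?thesis by (simp only: zero_le)
next
  case True
  then have far: "far_ind F s t = 1" by (simp add: far_ind_def)
  have "cis s \<noteq> cis t" using True factors[of s t] by auto
  then have d: "0 < cmod (cis s - cis t)" by simp
  then have "0 < \<bar>s - t\<bar>" using cmod_cis_diff_le[of s t] by linarith
  define a where "a n = c * (2 ^ n / (4 * pi))\<^sup>2" for n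
  have a: "0 \<le> a n" for n using assms by (simp add: a_def)
  define I where "I n i = {node n i..<node n (i + 2)}" for n i
  have level: "(\<Sum>i<2 ^ n. if s \<in> I n i \<and> t \<in> I n i then a n else 0)
      \<le> 2 * (if \<bar>s - t\<bar> < 4 * pi / 2 ^ n then a n else 0)" for n
  proof (cases "\<bar>s - t\<bar> < 4 * pi / 2 ^ n")
    case True
    have "(\<Sum>i<2 ^ n. if s \<in> I n i \<and> t \<in> I n i then a n else 0)
        \<le> (\<Sum>i<2 ^ n. if s \<in> I n i then a n else 0)"
      using a by (intro sum_mono) auto
    also have "\<dots> = real (card {i \<in> {..<2 ^ n}. s \<in> I n i}) * a n"
      by (subst sum.inter_filter[symmetric]) auto
    also have "\<dots> \<le> 2 * a n"
      using card_windows_containing[of "2 * pi / 2 ^ n" "2 ^ n" s] a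
      by (intro mult_right_mono) (auto simp: I_def node_def add.commute)
    finally show ?thesis using True by simp
  next
    case False
    have "\<not> (s \<in> I n i \<and> t \<in> I n i)" for i
    proof
      assume "s \<in> I n i \<and> t \<in> I n i"
      moreover have "node n (i + 2) = node n i + 4 * pi / 2 ^ n"
        by (simp add: node_def field_simps)
      ultimately show False using False by (auto simp: I_def)
    qed
    then have "(\<Sum>i<2 ^ n. if s \<in> I n i \<and> t \<in> I n i then a n else 0) = 0"
      by (intro sum.neutral) auto
    then show ?thesis using False by simp
  qed
  have "?L = (\<Sum>n<N. \<Sum>i<2 ^ n. ennreal (if s \<in> I n i \<and> t \<in> I n i then a n else 0))"
    by (intro sum.cong refl) (auto simp: far a_def I_def split: split_indicator)
  also have "\<dots> = ennreal (\<Sum>n<N. \<Sum>i<2 ^ n. if s \<in> I n i \<and> t \<in> I n i then a n else 0)"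
    using a by (simp add: sum_ennreal sum_nonneg)
  also have "\<dots> \<le> ennreal (8 / 3 * c * (1 / (cmod (cis s - cis t))\<^sup>2))"
  proof (rule ennreal_leI)
    have "(\<Sum>n<N. \<Sum>i<2 ^ n. if s \<in> I n i \<and> t \<in> I n i then a n else 0)
        \<le> (\<Sum>n<N. 2 * (if \<bar>s - t\<bar> < 4 * pi / 2 ^ n then a n else 0))"
      by (intro sum_mono level)
    also have "\<dots> = 2 * c * (\<Sum>n<N. if \<bar>s - t\<bar> < 4 * pi / 2 ^ n then (2 ^ n / (4 * pi))\<^sup>2 else 0)"
      unfolding sum_distrib_left by (intro sum.cong) (auto simp: a_def)
    also have "\<dots> \<le> 2 * c * (4 / 3 / \<bar>s - t\<bar>\<^sup>2)"
      using assms \<open>0 < \<bar>s - t\<bar>\<close> by (intro mult_left_mono sum_dyadic_scales) auto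
    also have "\<dots> \<le> 2 * c * (4 / 3 / (cmod (cis s - cis t))\<^sup>2)"
      using assms d cmod_cis_diff_le[of s t]
      by (intro mult_left_mono divide_left_mono power_mono mult_pos_pos zero_less_power) auto
    finally show "(\<Sum>n<N. \<Sum>i<2 ^ n. if s \<in> I n i \<and> t \<in> I n i then a n else 0)
        \<le> 8 / 3 * c * (1 / (cmod (cis s - cis t))\<^sup>2)" by simp
  qed
  also have "\<dots> = ?R"
  proof -
    have "ennreal (8 / 3 * c * (1 / (cmod (cis s - cis t))\<^sup>2))
        = ennreal (8 / 3 * c) * ennreal (1 / (cmod (cis s - cis t))\<^sup>2)"
      using assms by (intro ennreal_mult) auto
    then show ?thesis using True by (simp only: gap_kernel_def far) simp
  qed
  finally show ?thesis .
qed

text \<open>The constant is \<open>12500 * (8 / 3) * 4\<close>, the last factor being the passage from two periods to one.\<close>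

lemma abs_level_turn_le_gap_kernel:
  "ennreal \<bar>level_turn N\<bar> \<le> ennreal (400000 / 3 * pi) *
    (\<integral>\<^sup>+ s. \<integral>\<^sup>+ t. indicator {0..<2 * pi} s * indicator {0..<2 * pi} t * gap_kernel s t \<partial>lborel \<partial>lborel)"
proof -
  let ?c = "\<lambda>n. ennreal (12500 * pi * (2 ^ n / (4 * pi))\<^sup>2)"
  let ?w = "\<lambda>n i s t. indicator {node n i..<node n (i + 2)} s *
    indicator {node n i..<node n (i + 2)} t * far_ind F s t :: ennreal"
  let ?H = "\<lambda>p s t. indicator {0..<p} s * indicator {0..<p} t * gap_kernel s t :: ennreal"
  have "ennreal \<bar>level_turn N\<bar> \<le> (\<Sum>n<N. \<Sum>i<2 ^ n. ?c n * (\<integral>\<^sup>+ s. \<integral>\<^sup>+ t. ?w n i s t \<partial>lborel \<partial>lborel))"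
    using abs_level_turn_le[of N] by (simp only: far_mass_def)
  also have "\<dots> = (\<integral>\<^sup>+ s. \<integral>\<^sup>+ t. (\<Sum>n<N. \<Sum>i<2 ^ n. ?c n * ?w n i s t) \<partial>lborel \<partial>lborel)"
    by (simp add: nn_integral_sum nn_integral_cmult)
  also have "\<dots> \<le> (\<integral>\<^sup>+ s. \<integral>\<^sup>+ t. ennreal (8 / 3 * (12500 * pi)) * ?H (4 * pi) s t \<partial>lborel \<partial>lborel)"
    by (intro nn_integral_mono sum_windows_le_gap_kernel) simp
  also have "\<dots> = ennreal (8 / 3 * (12500 * pi)) * (\<integral>\<^sup>+ s. \<integral>\<^sup>+ t. ?H (4 * pi) s t \<partial>lborel \<partial>lborel)"
    by (simp add: nn_integral_cmult)
  also have "(\<integral>\<^sup>+ s. \<integral>\<^sup>+ t. ?H (4 * pi) s t \<partial>lborel \<partial>lborel)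
      = 4 * (\<integral>\<^sup>+ s. \<integral>\<^sup>+ t. ?H (2 * pi) s t \<partial>lborel \<partial>lborel)"
  proof -
    have cis_per: "cis (x + 2 * pi) = cis x" for x by (simp flip: cis_mult)
    have per: "gap_kernel (s + 2 * pi) t = gap_kernel s t" "gap_kernel s (t + 2 * pi) = gap_kernel s t" for s t
      by (simp_all add: gap_kernel_def far_ind_def periodic cis_per)
    have out: "(\<integral>\<^sup>+ t. ?H p s t \<partial>lborel)
        = indicator {0..<p} s * (\<integral>\<^sup>+ t. indicator {0..<p} t * gap_kernel s t \<partial>lborel)" for p s
      by (simp add: mult.assoc nn_integral_cmult)
    have inner: "(\<integral>\<^sup>+ t. indicator {0..<2 * (2 * pi)} t * gap_kernel s t \<partial>lborel)
        = 2 * (\<integral>\<^sup>+ t. indicator {0..<2 * pi} t * gap_kernel s t \<partial>lborel)" for s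
      by (rule nn_integral_two_periods) (auto simp: per)
    have "(\<integral>\<^sup>+ s. indicator {0..<2 * (2 * pi)} s * (2 * (\<integral>\<^sup>+ t. indicator {0..<2 * pi} t * gap_kernel s t \<partial>lborel)) \<partial>lborel)
        = 2 * (\<integral>\<^sup>+ s. indicator {0..<2 * pi} s * (2 * (\<integral>\<^sup>+ t. indicator {0..<2 * pi} t * gap_kernel s t \<partial>lborel)) \<partial>lborel)"
      by (rule nn_integral_two_periods) (auto simp: per)
    also have "\<dots> = 2 * (2 * (\<integral>\<^sup>+ s. indicator {0..<2 * pi} s * (\<integral>\<^sup>+ t. indicator {0..<2 * pi} t * gap_kernel s t \<partial>lborel) \<partial>lborel))"
      by (subst nn_integral_cmult[symmetric]) (auto simp: mult_ac)
    finally show ?thesis unfolding out inner[symmetric] by (simp add: mult.assoc[symmetric])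
  qed
  finally show ?thesis
    by (simp add: mult.assoc[symmetric] ennreal_mult'[symmetric] flip: ennreal_numeral)
qed

end

section \<open>The estimate for circle maps\<close>

lemma I_delta_eq:
  assumes f: "continuous_on unit_circle f" "f ` unit_circle \<subseteq> unit_circle"
  shows "I_delta \<delta> f = (\<integral>\<^sup>+ s. \<integral>\<^sup>+ t. indicator {0..<2 * pi} s * indicator {0..<2 * pi} t *
    ennreal ((if \<delta> \<le> cmod (f (cis s) - f (cis t)) then 1 else 0) / (cmod (cis s - cis t))\<^sup>2)
    \<partial>lborel \<partial>lborel)"
proof -
  define k where "k x y = ennreal ((if \<delta> \<le> cmod (f x - f y) then 1 else 0) / (cmod (x - y))\<^sup>2)"
    for x y :: complex
  let ?C = "restrict_space borel unit_circle :: complex measure"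
  have fm [measurable]: "f \<in> borel_measurable ?C"
    using f(1) by (rule borel_measurable_continuous_on_restrict)
  have id [measurable]: "(\<lambda>x. x) \<in> borel_measurable ?C"
    by (intro measurable_restrict_space1) simp
  have pair: "(\<lambda>p. k (snd p) (fst p)) \<in> borel_measurable (?C \<Otimes>\<^sub>M ?C)"
    unfolding k_def
    using measurable_compose[OF measurable_fst id] measurable_compose[OF measurable_snd id]
    by measurable
  have sec: "(\<lambda>x. k x y) \<in> borel_measurable ?C" for y
    unfolding k_def using id by measurable
  have cis_m: "cis \<in> measurable (restrict_space lborel {0..<2 * pi}) ?C" by (rule cis_measurable)
  have inner: "(\<integral>\<^sup>+ x. k x y \<partial>arclength) = (\<integral>\<^sup>+ t. indicator {0..<2 * pi} t * k (cis t) y \<partial>lborel)" for y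
    unfolding arclength_def using sec
    by (subst nn_integral_distr[OF cis_m]) (auto simp: nn_integral_restrict_space mult.commute)
  have sf: "sigma_finite_measure arclength"
  proof -
    have "finite_measure arclength"
      by (intro finite_measureI) (simp add: space_arclength emeasure_arclength_total)
    then show ?thesis by (simp add: finite_measure.axioms)
  qed
  have "(\<lambda>y. \<integral>\<^sup>+ x. k x y \<partial>arclength) \<in> borel_measurable ?C"
  proof (rule sigma_finite_measure.borel_measurable_nn_integral[OF sf])
    have "sets (?C \<Otimes>\<^sub>M arclength) = sets (?C \<Otimes>\<^sub>M ?C)"
      by (intro sets_pair_measure_cong) (auto simp: sets_arclength)
    then show "(\<lambda>(y, x). k x y) \<in> borel_measurable (?C \<Otimes>\<^sub>M arclength)"
      using pair by (subst measurable_cong_sets) (auto simp: case_prod_unfold)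
  qed
  then have "I_delta \<delta> f = (\<integral>\<^sup>+ s. indicator {0..<2 * pi} s * (\<integral>\<^sup>+ x. k x (cis s) \<partial>arclength) \<partial>lborel)"
    unfolding I_delta_def k_def[symmetric]
    by (subst arclength_def, subst nn_integral_distr[OF cis_m]) 
      (auto simp: nn_integral_restrict_space mult.commute)
  also have "\<dots> = (\<integral>\<^sup>+ s. \<integral>\<^sup>+ t. indicator {0..<2 * pi} s * indicator {0..<2 * pi} t * k (cis t) (cis s) \<partial>lborel \<partial>lborel)"
    unfolding inner
    by (intro nn_integral_cong) (auto split: split_indicator)
  finally show ?thesis unfolding k_def by (simp only: norm_minus_commute)
qed

lemma lift_of_circle_map:
  assumes f: "continuous_on unit_circle f" "f ` unit_circle \<subseteq> unit_circle"
  obtains \<phi> where "continuous_on {0..2 * pi} \<phi>"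
    "\<And>t. t \<in> {0..2 * pi} \<Longrightarrow> f (cis t) = cis (\<phi> t)"
    "\<phi> (2 * pi) - \<phi> 0 = 2 * pi * circle_degree f"
proof -
  let ?p = "f \<circ> circlepath 0 1"
  have p: "path ?p"
    by (rule path_continuous_image) (use f in simp_all)
  have p0: "0 \<notin> path_image ?p" using f(2) by (auto simp: path_image_compose)
  have circ: "circlepath 0 1 t = cis (2 * pi * t)" for t
    by (simp add: circlepath cis_conv_exp mult_ac)
  obtain q where q: "path q" "pathfinish q - pathstart q = 2 * of_real pi * \<i> * winding_number ?p 0"
    "\<And>t. t \<in> {0..1} \<Longrightarrow> ?p t = 0 + exp (q t)"
    using winding_number_as_continuous_log[OF p p0] by blast
  show thesis
  proof (rule that[of "\<lambda>t. Im (q (t / (2 * pi)))"])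
    show "continuous_on {0..2 * pi} (\<lambda>t. Im (q (t / (2 * pi))))"
      by (intro continuous_intros continuous_on_compose2[OF q(1)[unfolded path_def]])
        (auto simp: field_simps)
    show "f (cis t) = cis (Im (q (t / (2 * pi))))" if "t \<in> {0..2 * pi}" for t
    proof -
      have "t / (2 * pi) \<in> {0..1}" using that by (auto simp: field_simps)
      from q(3)[OF this] have eq: "f (cis t) = exp (q (t / (2 * pi)))"
        by (simp add: circ)
      moreover have "cmod (f (cis t)) = 1" using f(2) norm_cis[of t] by (metis image_subset_iff mem_sphere_0)
      ultimately have "exp (Re (q (t / (2 * pi)))) = 1" by simp
      then show ?thesis unfolding eq by (simp add: exp_eq_polar)
    qed
    have "pathfinish q - pathstart q = 2 * of_real pi * \<i> * of_int (circle_degree f)"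
      unfolding q(2) circle_degree_eq_winding_number[OF f] ..
    then have "Im (pathfinish q - pathstart q) = Im (2 * of_real pi * \<i> * of_int (circle_degree f))"
      by simp
    then show "Im (q (2 * pi / (2 * pi))) - Im (q (0 / (2 * pi))) = 2 * pi * circle_degree f"
      by (simp add: pathfinish_def pathstart_def)
  qed
qed

theorem theorem1p4:
  "\<exists>c::real. c > 0 \<and>
    (\<forall>(f :: complex \<Rightarrow> complex) (\<delta> :: real).
      continuous_on unit_circle f \<longrightarrow> f ` unit_circle \<subseteq> unit_circle \<longrightarrow>
      0 < \<delta> \<longrightarrow> \<delta> \<le> sqrt 3 \<longrightarrow>
      ennreal (real_of_int \<bar>circle_degree f\<bar>) \<le> ennreal (c * \<delta>) * I_delta \<delta> f)"
proof (intro exI[of _ "400000 / 3 * pi"] conjI allI impI)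
  fix f :: "complex \<Rightarrow> complex" and \<delta> :: real
  assume f: "continuous_on unit_circle f" "f ` unit_circle \<subseteq> unit_circle"
    and \<delta>: "0 < \<delta>" "\<delta> \<le> sqrt 3"
  have f1: "cmod (f (cis t)) = 1" for t
    using f(2) norm_cis[of t] by (metis image_subset_iff mem_sphere_0)
  obtain \<phi> where \<phi>: "continuous_on {0..2 * pi} \<phi>"
    "\<And>t. t \<in> {0..2 * pi} \<Longrightarrow> f (cis t) = cis (\<phi> t)"
    "\<phi> (2 * pi) - \<phi> 0 = 2 * pi * circle_degree f"
    using lift_of_circle_map[OF f] by blast
  \<comment> \<open>The largest power whose far pairs at \<open>\<surd>3\<close> are still far pairs of \<open>f\<close> at \<open>\<delta>\<close>; it satisfies \<open>2 * k * \<delta> \<ge> \<surd>3\<close>.\<close>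
  define k where "k = nat \<lfloor>sqrt 3 / \<delta>\<rfloor>"
  have "1 \<le> sqrt 3 / \<delta>" using \<delta> by simp
  then have k1: "1 \<le> k" and k_le: "real k \<le> sqrt 3 / \<delta>" and k_ge: "sqrt 3 / \<delta> < k + 1"
    unfolding k_def by linarith+
  have k: "k * \<delta> \<le> sqrt 3" "sqrt 3 \<le> 2 * (k * \<delta>)"
  proof -
    show "k * \<delta> \<le> sqrt 3" using k_le \<delta> by (simp add: field_simps)
    have "sqrt 3 < (k + 1) * \<delta>" using k_ge \<delta> by (simp add: field_simps)
    also have "\<dots> \<le> (2 * k) * \<delta>" using k1 \<delta> by (intro mult_right_mono) auto
    finally show "sqrt 3 \<le> 2 * (k * \<delta>)" by simp
  qed
  define F where "F t = f (cis t) ^ k" for t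
  interpret periodic_unit_curve F
  proof
    show "continuous_on UNIV F"
      unfolding F_def
      by (intro continuous_intros continuous_on_compose2[OF f(1)] continuous_on_cis) auto
  qed (auto simp: F_def norm_power f1)
  have lift: "F t = cis (k * \<phi> t)" if "t \<in> {0..2 * pi}" for t
    using \<phi>(2)[OF that] by (simp add: F_def Complex.DeMoivre)
  have "continuous_on {0..2 * pi} (\<lambda>t. k * \<phi> t)" using \<phi>(1) by (intro continuous_intros)
  from level_turn_eventually[OF this lift] obtain N
    where "level_turn N = k * \<phi> (2 * pi) - k * \<phi> 0" by blast
  then have N: "level_turn N = k * (2 * pi * circle_degree f)"
    using \<phi>(3) by (simp flip: right_diff_distrib)
  have "gap_kernel s t \<le>
      ennreal ((if \<delta> \<le> cmod (f (cis s) - f (cis t)) then 1 else 0) / (cmod (cis s - cis t))\<^sup>2)" for s t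
  proof (cases "sqrt 3 \<le> cmod (F s - F t)")
    case True
    have "k * \<delta> \<le> k * cmod (f (cis s) - f (cis t))"
      using True k norm_power_diff[of "f (cis s)" "f (cis t)" k] f1 by (simp add: F_def)
    then have "\<delta> \<le> cmod (f (cis s) - f (cis t))" using k1 by simp
    then show ?thesis by (simp add: gap_kernel_def far_ind_def)
  qed (simp add: gap_kernel_def far_ind_def)
  then have "(\<integral>\<^sup>+ s. \<integral>\<^sup>+ t. indicator {0..<2 * pi} s * indicator {0..<2 * pi} t * gap_kernel s t \<partial>lborel \<partial>lborel)
      \<le> I_delta \<delta> f"
    unfolding I_delta_eq[OF f] by (intro nn_integral_mono mult_left_mono) auto
  then have main: "ennreal \<bar>level_turn N\<bar> \<le> ennreal (400000 / 3 * pi) * I_delta \<delta> f"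
    using abs_level_turn_le_gap_kernel[of N] by (meson mult_left_mono order.trans zero_le)
  have "\<bar>circle_degree f\<bar> \<le> \<delta> * \<bar>level_turn N\<bar>"
  proof -
    have "1 \<le> sqrt (3 :: real)" by simp
    then have "1 \<le> 2 * (k * \<delta>)" using k(2) by linarith
    then have "1 * 1 \<le> 2 * (k * \<delta>) * pi" using pi_gt3 by (intro mult_mono) auto
    then have "1 * real_of_int \<bar>circle_degree f\<bar> \<le> 2 * (k * \<delta>) * pi * real_of_int \<bar>circle_degree f\<bar>"
      by (intro mult_right_mono) auto
    then show ?thesis by (simp add: N abs_mult mult_ac)
  qed
  then have "ennreal (real_of_int \<bar>circle_degree f\<bar>) \<le> ennreal \<delta> * ennreal \<bar>level_turn N\<bar>"
    using \<delta> by (subst ennreal_mult[symmetric]) (auto intro: ennreal_leI)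
  also have "\<dots> \<le> ennreal \<delta> * (ennreal (400000 / 3 * pi) * I_delta \<delta> f)"
    using main by (rule mult_left_mono) simp
  also have "\<dots> = ennreal (400000 / 3 * pi * \<delta>) * I_delta \<delta> f"
    using \<delta> by (subst ennreal_mult) (auto simp: mult_ac)
  finally show "ennreal (real_of_int \<bar>circle_degree f\<bar>) \<le> ennreal (400000 / 3 * pi * \<delta>) * I_delta \<delta> f" .
qed simp

end
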